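(* Let $S$ be an invariant surface in Sol with constant mean curvature $H\neq 0$, and let $\alpha(s)=(0,y(s),z(s))$, $s\in\mathbb{R}$, be its (maximal) generating curve. Then: (1) The curve $\alpha$ is invariant under a discrete group of translations in the $y$-direction: there is $\tau\neq 0$ such that the image of $\alpha$ is invariant under $(0,y,z)\mapsto(0,y+n\tau,z)$ for all $n\in\mathbb{Z}$. (2) The coordinate function $z(s)$ is bounded and periodic. (3) The curve $\alpha$ has self-intersections, i.e. there are $s_1\neq s_2$ with $\alpha(s_1)=\alpha(s_2)$. (4) The velocity vector of $\alpha$ turns around the origin: $\alpha'(s)=\cos\theta(s)E_2+\sin\theta(s)E_3$ takes, in a monotonic sense (that is, with $\theta$ strictly monotonic), all the values of the unit circle.
   Context: Sol is $\mathbb{R}^3$ with the Riemannian metric $e^{2z}dx^2+e^{-2z}dy^2+dz^2$. An orthonormal frame is $E_1=e^{-z}\partial_x$, $E_2=e^{z}\partial_y$, $E_3=\partial_z$. An invariant surface is a surface invariant under the one-parameter group of isometries $T_{1,c}(x,y,z)=(x+c,y,z)$, $c\in\mathbb{R}$. It is parametrized (as an immersed surface) by $X(s,t)=(t,y(s),z(s))$, $t\in\mathbb{R}$, where $\alpha(s)=(0,y(s),z(s))$ is the generating curve, parametrized by arc length: $y'=e^{z}\cos\theta$, $z'=\sin\theta$ for a smooth angle function $\theta=\theta(s)$. The surface is oriented by $N=-\sin\theta\,E_2+\cos\theta\,E_3$, and $H$ is the average of the two principal curvatures. The generating curve is taken maximal, i.e. it is extended to its maximal interval of definition as a curve generating a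 surface with the given constant $H$; this interval is $\mathbb{R}$. *)

theory Defs
  imports "HOL-Analysis.Analysis"
begin

section \<open>Riemannian geometry in a single chart\<close>

text \<open>
  A Riemannian metric on \<open>real ^ 'n\<close> is given by its Gram matrix at each point. The Christoffel symbol
  \<open>\<Gamma>\<^sup>k\<^bsub>ij\<^esub>\<close> of the Levi-Civita connection is \<open>christoffel g p k i j\<close>.
\<close>

definition partial_deriv :: "'n \<Rightarrow> (real ^ 'n \<Rightarrow> real) \<Rightarrow> real ^ 'n \<Rightarrow> real" where
  "partial_deriv i f p = deriv (\<lambda>h. f (p + h *\<^sub>R axis i 1)) 0"

definition christoffel ::
  "(real ^ 'n \<Rightarrow> real ^ 'n ^ 'n) \<Rightarrow> real ^ 'n \<Rightarrow> 'n::finite \<Rightarrow> 'n \<Rightarrow> 'n \<Rightarrow> real" where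
  "christoffel g p k i j =
     (1 / 2) * (\<Sum>l\<in>UNIV. matrix_inv (g p) $ k $ l *
       (partial_deriv i (\<lambda>q. g q $ j $ l) p
        + partial_deriv j (\<lambda>q. g q $ i $ l) p
        - partial_deriv l (\<lambda>q. g q $ i $ j) p))"

definition metric_inner ::
  "(real ^ 'n \<Rightarrow> real ^ 'n ^ 'n) \<Rightarrow> real ^ 'n \<Rightarrow> real ^ 'n \<Rightarrow> real ^ 'n::finite \<Rightarrow> real" where
  "metric_inner g p u v = u \<bullet> (g p *v v)"

definition cov_deriv_along ::
  "(real ^ 'n \<Rightarrow> real ^ 'n ^ 'n) \<Rightarrow> (real \<Rightarrow> real ^ 'n) \<Rightarrow> (real \<Rightarrow> real ^ 'n::finite) \<Rightarrow> real
    \<Rightarrow> real ^ 'n" where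
  "cov_deriv_along g c V s =
     vector_derivative V (at s) +
     (\<chi> k. \<Sum>i\<in>UNIV. \<Sum>j\<in>UNIV.
        christoffel g (c s) k i j * (vector_derivative c (at s) $ i) * (V s $ j))"

text \<open>
  For a parametrized surface \<open>X\<close> in a 3-manifold, tangent vectors at \<open>X s t\<close> are represented by their
  coordinates \<open>(a, b)\<close> with respect to the basis of partial derivatives of \<open>X\<close>. For a unit normal field
  \<open>N\<close> along \<open>X\<close>, the shape operator maps a tangent vector \<open>v\<close> to \<open>- \<nabla>\<^bsub>v\<^esub> N\<close>.
\<close>

definition tangent_vector ::
  "(real \<Rightarrow> real \<Rightarrow> real ^ 3) \<Rightarrow> real \<Rightarrow> real \<Rightarrow> real \<times> real \<Rightarrow> real ^ 3" where
  "tangent_vector X s t v =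
     fst v *\<^sub>R vector_derivative (\<lambda>u. X u t) (at s) +
     snd v *\<^sub>R vector_derivative (\<lambda>u. X s u) (at t)"

definition shape_operator ::
  "(real ^ 3 \<Rightarrow> real ^ 3 ^ 3) \<Rightarrow> (real \<Rightarrow> real \<Rightarrow> real ^ 3) \<Rightarrow> (real \<Rightarrow> real \<Rightarrow> real ^ 3)
    \<Rightarrow> real \<Rightarrow> real \<Rightarrow> real \<times> real \<Rightarrow> real ^ 3" where
  "shape_operator g X N s t v =
     - (fst v *\<^sub>R cov_deriv_along g (\<lambda>u. X u t) (\<lambda>u. N u t) s +
        snd v *\<^sub>R cov_deriv_along g (\<lambda>u. X s u) (\<lambda>u. N s u) t)"

text \<open>
  The two principal curvatures, counted with multiplicity, are the eigenvalues belonging to an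
  orthonormal basis of the tangent plane consisting of eigenvectors of the shape operator.
\<close>

definition principal_curvatures ::
  "(real ^ 3 \<Rightarrow> real ^ 3 ^ 3) \<Rightarrow> (real \<Rightarrow> real \<Rightarrow> real ^ 3) \<Rightarrow> (real \<Rightarrow> real \<Rightarrow> real ^ 3)
    \<Rightarrow> real \<Rightarrow> real \<Rightarrow> real \<Rightarrow> real \<Rightarrow> bool" where
  "principal_curvatures g X N s t k1 k2 \<longleftrightarrow>
     (\<exists>v1 v2.
        metric_inner g (X s t) (tangent_vector X s t v1) (tangent_vector X s t v1) = 1 \<and>
        metric_inner g (X s t) (tangent_vector X s t v2) (tangent_vector X s t v2) = 1 \<and>
        metric_inner g (X s t) (tangent_vector X s t v1) (tangent_vector X s t v2) = 0 \<and>
        shape_operator g X N s t v1 = k1 *\<^sub>R tangent_vector X s t v1 \<and>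
        shape_operator g X N s t v2 = k2 *\<^sub>R tangent_vector X s t v2)"

definition has_mean_curvature ::
  "(real ^ 3 \<Rightarrow> real ^ 3 ^ 3) \<Rightarrow> (real \<Rightarrow> real \<Rightarrow> real ^ 3) \<Rightarrow> (real \<Rightarrow> real \<Rightarrow> real ^ 3)
    \<Rightarrow> real \<Rightarrow> real \<Rightarrow> real \<Rightarrow> bool" where
  "has_mean_curvature g X N s t H \<longleftrightarrow>
     (\<exists>k1 k2. principal_curvatures g X N s t k1 k2 \<and> H = (k1 + k2) / 2)"

section \<open>Sol and its invariant surfaces\<close>

definition sol_metric :: "real ^ 3 \<Rightarrow> real ^ 3 ^ 3" where
  "sol_metric p =
     vector [vector [exp (2 * p $ 3), 0, 0],
             vector [0, exp (- 2 * p $ 3), 0],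
             vector [0, 0, 1]]"

definition E2 :: "real ^ 3 \<Rightarrow> real ^ 3" where
  "E2 p = vector [0, exp (p $ 3), 0]"

definition E3 :: "real ^ 3 \<Rightarrow> real ^ 3" where
  "E3 p = vector [0, 0, 1]"

definition gen_curve :: "(real \<Rightarrow> real) \<Rightarrow> (real \<Rightarrow> real) \<Rightarrow> real \<Rightarrow> real ^ 3" where
  "gen_curve y z s = vector [0, y s, z s]"

definition inv_surface :: "(real \<Rightarrow> real) \<Rightarrow> (real \<Rightarrow> real) \<Rightarrow> real \<Rightarrow> real \<Rightarrow> real ^ 3" where
  "inv_surface y z s t = vector [t, y s, z s]"

definition inv_normal ::
  "(real \<Rightarrow> real) \<Rightarrow> (real \<Rightarrow> real) \<Rightarrow> (real \<Rightarrow> real) \<Rightarrow> real \<Rightarrow> real \<Rightarrow> real ^ 3" where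
  "inv_normal y z \<theta> s t =
     - sin (\<theta> s) *\<^sub>R E2 (inv_surface y z s t) + cos (\<theta> s) *\<^sub>R E3 (inv_surface y z s t)"

text \<open>Infinite differentiability, for open \<open>I\<close> only: there \<open>deriv\<close> at points of \<open>I\<close> depends only on \<open>f\<close> on \<open>I\<close>.\<close>

definition smooth_on_open :: "real set \<Rightarrow> (real \<Rightarrow> real) \<Rightarrow> bool" where
  "smooth_on_open I f \<longleftrightarrow> (\<forall>k. (deriv ^^ k) f differentiable_on I)"

text \<open>
  The equations for \<open>y'\<close> and \<open>z'\<close> say that the curve is parametrized by arc length with angle \<open>\<theta>\<close>;
  they make \<open>y\<close> and \<open>z\<close> smooth once \<open>\<theta>\<close> is. Values of \<open>y\<close>, \<open>z\<close>, \<open>\<theta>\<close> outside \<open>I\<close> are irrelevant.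
\<close>

definition cmc_generating_curve ::
  "real \<Rightarrow> real set \<Rightarrow> (real \<Rightarrow> real) \<Rightarrow> (real \<Rightarrow> real) \<Rightarrow> (real \<Rightarrow> real) \<Rightarrow> bool" where
  "cmc_generating_curve H I y z \<theta> \<longleftrightarrow>
     open I \<and> is_interval I \<and> I \<noteq> {} \<and>
     smooth_on_open I \<theta> \<and>
     (\<forall>s\<in>I. (y has_real_derivative exp (z s) * cos (\<theta> s)) (at s)) \<and>
     (\<forall>s\<in>I. (z has_real_derivative sin (\<theta> s)) (at s)) \<and>
     (\<forall>s\<in>I. \<forall>t. has_mean_curvature sol_metric (inv_surface y z) (inv_normal y z \<theta>) s t H)"

definition maximal_cmc_generating_curve ::
  "real \<Rightarrow> real set \<Rightarrow> (real \<Rightarrow> real) \<Rightarrow> (real \<Rightarrow> real) \<Rightarrow> (real \<Rightarrow> real) \<Rightarrow> bool" where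
  "maximal_cmc_generating_curve H I y z \<theta> \<longleftrightarrow>
     cmc_generating_curve H I y z \<theta> \<and>
     (\<forall>J y' z' \<theta>'. cmc_generating_curve H J y' z' \<theta>' \<longrightarrow> I \<subseteq> J \<longrightarrow>
        (\<forall>s\<in>I. gen_curve y' z' s = gen_curve y z s) \<longrightarrow> J = I)"

end

theory Submission
  imports Defs
begin

text \<open>
  The principal directions of an invariant surface are the ruling \<open>E\<^sub>1\<close> and the unit tangent
  \<open>T = cos \<theta> E\<^sub>2 + sin \<theta> E\<^sub>3\<close> of the generating curve. From \<open>\<nabla>\<^bsub>E1\<^esub> N = cos \<theta> E\<^sub>1\<close> and
  \<open>\<nabla>\<^bsub>T\<^esub> N = - (\<theta>' + cos \<theta>) T\<close> the principal curvatures are \<open>- cos \<theta>\<close> and \<open>\<theta>' + cos \<theta>\<close>. Their sum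
  is \<open>\<theta>'\<close>: the zeroth-order terms cancel, and mean curvature \<open>H\<close> just says \<open>\<theta>' = 2 H\<close>
  (\<open>has_mean_curvature_inv_surface_iff\<close>).

  Everything is therefore explicit: \<open>\<theta>\<close> is affine in \<open>s\<close>, \<open>z' = sin \<theta>\<close> integrates to
  \<open>z = c - cos \<theta> / (2 H)\<close>, and \<open>y\<close> is a primitive of a function defined for all \<open>s\<close>. So every
  solution on an interval extends to the whole line, which gives \<open>I = UNIV\<close> for a maximal curve
  (\<open>maximal_cmc_generating_curve_UNIV\<close>). The monotone rotation of the velocity, the boundedness and
  the periodicity of \<open>z\<close> are visible from the formulas.

  For the statements about the shape of the curve, take \<open>\<phi> = \<theta> s\<close> as parameter and put
  \<open>k = 1 / (2 H)\<close>. The ordinate becomes a function \<open>P\<close> with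
  \<open>P' = k exp (c - k cos \<phi>) cos \<phi>\<close>, the height being \<open>c - k cos \<phi>\<close>. The derivative is
  \<open>2 \<pi>\<close>-periodic, so \<open>P\<close> gains a fixed amount \<open>\<tau>\<close> per turn, which is the translation in the
  \<open>y\<close>-direction. Integration by parts shows \<open>\<tau> < 0\<close> (\<open>profile_translation\<close>). On the other hand
  \<open>P' > 0\<close> at one of the angles \<open>0\<close>, \<open>\<pi>\<close>; starting there, \<open>P\<close> first increases but ends below its
  initial value after one turn, so it takes this value again in between. By the reflection symmetry
  about that angle the curve passes through a common point twice (\<open>profile_double_point\<close>).
\<close>

section \<open>The Levi-Civita connection of Sol\<close>

lemma sol_metric_nth [simp]:
  "sol_metric p $ 1 $ 1 = exp (2 * p $ 3)" "sol_metric p $ 1 $ 2 = 0" "sol_metric p $ 1 $ 3 = 0"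
  "sol_metric p $ 2 $ 1 = 0" "sol_metric p $ 2 $ 2 = exp (- 2 * p $ 3)" "sol_metric p $ 2 $ 3 = 0"
  "sol_metric p $ 3 $ 1 = 0" "sol_metric p $ 3 $ 2 = 0" "sol_metric p $ 3 $ 3 = 1"
  by (simp_all add: sol_metric_def)

lemma matrix_inv_sol_metric:
  "matrix_inv (sol_metric p) =
     vector [vector [exp (- 2 * p $ 3), 0, 0], vector [0, exp (2 * p $ 3), 0], vector [0, 0, 1]]"
  (is "_ = ?B")
proof -
  have AB: "sol_metric p ** ?B = mat 1"
    by (simp add: vec_eq_iff forall_3 matrix_matrix_mult_def sum_3 mat_def exp_add [symmetric])
  then have BA: "?B ** sol_metric p = mat 1"
    by (rule iffD1 [OF matrix_left_right_inverse])
  have "sol_metric p ** matrix_inv (sol_metric p) = mat 1 \<and> matrix_inv (sol_metric p) ** sol_metric p = mat 1"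
    unfolding matrix_inv_def by (rule someI [of _ ?B]) (intro conjI AB BA)
  then have "matrix_inv (sol_metric p) ** (sol_metric p ** ?B) = ?B"
    by (simp only: matrix_mul_assoc matrix_mul_lid)
  then show ?thesis
    by (simp only: AB matrix_mul_rid)
qed

lemma partial_deriv_const [simp]: "partial_deriv i (\<lambda>_. c) p = 0"
  by (simp add: partial_deriv_def)

lemma partial_deriv_exp_component:
  "partial_deriv i (\<lambda>q. exp (c * q $ m)) p = (if i = m then c * exp (c * p $ m) else 0)"
proof -
  have "((\<lambda>h. exp (c * (p + h *\<^sub>R axis i 1) $ m)) has_real_derivative
          (if i = m then c * exp (c * p $ m) else 0)) (at 0)"
    by (auto simp: axis_def intro!: derivative_eq_intros)
  then show ?thesis
    unfolding partial_deriv_def by (rule DERIV_imp_deriv)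
qed

lemma christoffel_sol_metric:
  "christoffel sol_metric p k i j =
     (if k = 1 \<and> (i = 1 \<and> j = 3 \<or> i = 3 \<and> j = 1) then 1
      else if k = 2 \<and> (i = 2 \<and> j = 3 \<or> i = 3 \<and> j = 2) then - 1
      else if k = 3 \<and> i = 1 \<and> j = 1 then - exp (2 * p $ 3)
      else if k = 3 \<and> i = 2 \<and> j = 2 then exp (- 2 * p $ 3)
      else 0)"
  using exhaust_3 [of k] exhaust_3 [of i] exhaust_3 [of j]
  by (elim disjE; simp add: christoffel_def matrix_inv_sol_metric sum_3 partial_deriv_exp_component
      partial_deriv_exp_component [of _ "-2", simplified] exp_add [symmetric])

lemma has_vector_derivative_vector_3:
  assumes "(f has_real_derivative f') (at s)" "(g has_real_derivative g') (at s)"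
    "(h has_real_derivative h') (at s)"
  shows "((\<lambda>u. vector [f u, g u, h u] :: real ^ 3) has_vector_derivative vector [f', g', h']) (at s)"
proof -
  have eq: "(vector [a, b, c] :: real ^ 3) = a *\<^sub>R axis 1 1 + b *\<^sub>R axis 2 1 + c *\<^sub>R axis 3 1" for a b c
    by (simp add: vec_eq_iff forall_3 axis_def)
  show ?thesis
    unfolding eq
    using assms by (auto intro!: derivative_eq_intros)
qed

section \<open>The mean curvature of an invariant surface\<close>

text \<open>
  Principal curvatures are given by some orthonormal eigenbasis, so their sum has to be recognised as
  a trace. The rows of an orthogonal \<open>2 \<times> 2\<close> matrix being orthonormal, so are its columns, and
  \<open>k = p a\<^sup>2 + q b\<^sup>2\<close>, \<open>k' = p a'\<^sup>2 + q b'\<^sup>2\<close> add up to \<open>p + q\<close>.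
\<close>

lemma trace_of_diagonal_in_orthonormal_basis:
  fixes a b a' b' :: real
  assumes orth: "a\<^sup>2 + b\<^sup>2 = 1" "a'\<^sup>2 + b'\<^sup>2 = 1" "a * a' + b * b' = 0"
    and eigen: "p * a = k * a" "q * b = k * b" "p * a' = k' * a'" "q * b' = k' * b'"
  shows "k + k' = p + q"
proof -
  have "(a * a')\<^sup>2 = (b * b')\<^sup>2"
    using orth(3) by (simp add: eq_neg_iff_add_eq_0 [symmetric])
  moreover have "b\<^sup>2 = 1 - a\<^sup>2" "b'\<^sup>2 = 1 - a'\<^sup>2"
    using orth(1,2) by simp_all
  ultimately have "a\<^sup>2 * a'\<^sup>2 = (1 - a\<^sup>2) * (1 - a'\<^sup>2)"
    by (simp add: power_mult_distrib)
  then have columns: "a\<^sup>2 + a'\<^sup>2 = 1" "b\<^sup>2 + b'\<^sup>2 = 1"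
    using orth(1,2) by algebra+
  have "k + k' = k * (a\<^sup>2 + b\<^sup>2) + k' * (a'\<^sup>2 + b'\<^sup>2)"
    using orth by simp
  also have "\<dots> = p * (a\<^sup>2 + a'\<^sup>2) + q * (b\<^sup>2 + b'\<^sup>2)"
    using eigen by algebra
  finally show ?thesis
    using columns by simp
qed

text \<open>
  Reflections in the planes of constant \<open>x\<close> are isometries of Sol that preserve the surface and its
  normal. The shape operator commutes with them, so it is diagonal in the directions \<open>T\<close> and \<open>E\<^sub>1\<close>;
  its entries are \<open>w + cos \<theta>\<close> and \<open>- cos \<theta>\<close>, and the terms \<open>\<plusminus> cos \<theta>\<close> cancel in the trace. The
  first coordinate of a parameter vector \<open>v\<close> is its component along \<open>T\<close>; its component along
  \<open>E\<^sub>1 = exp (- z) \<partial>\<^sub>x\<close> is \<open>exp z\<close> times the second coordinate.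
\<close>

lemma has_mean_curvature_inv_surface_iff:
  assumes y: "(y has_real_derivative exp (z s) * cos (\<theta> s)) (at s)"
    and z: "(z has_real_derivative sin (\<theta> s)) (at s)"
    and \<theta>: "(\<theta> has_real_derivative w) (at s)"
  shows "has_mean_curvature sol_metric (inv_surface y z) (inv_normal y z \<theta>) s t H \<longleftrightarrow> w = 2 * H"
proof -
  let ?X = "inv_surface y z" and ?N = "inv_normal y z \<theta>"
  let ?Z = "exp (z s)" and ?S = "sin (\<theta> s)" and ?C = "cos (\<theta> s)"
  have X: "?X u v = vector [v, y u, z u]" for u v
    by (simp add: inv_surface_def)
  have N: "?N u v = vector [0, - (sin (\<theta> u) * exp (z u)), cos (\<theta> u)]" for u v
    by (simp add: inv_normal_def E2_def E3_def inv_surface_def vec_eq_iff forall_3)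
  have Xs: "vector_derivative (\<lambda>u. vector [t, y u, z u] :: real ^ 3) (at s) = vector [0, ?Z * ?C, ?S]"
    by (intro vector_derivative_at has_vector_derivative_vector_3 y z) auto
  have Xt: "vector_derivative (\<lambda>u. vector [u, y s, z s] :: real ^ 3) (at t) = vector [1, 0, 0]"
    by (intro vector_derivative_at has_vector_derivative_vector_3) auto
  have Ns: "vector_derivative
      (\<lambda>u. vector [0, - (sin (\<theta> u) * exp (z u)), cos (\<theta> u)] :: real ^ 3) (at s) =
      vector [0, - (?C * w * ?Z + ?S * ?Z * ?S), - ?S * w]"
    by (intro vector_derivative_at has_vector_derivative_vector_3)
      (auto intro!: derivative_eq_intros y z \<theta>)
  have tan: "tangent_vector ?X s t v = vector [snd v, fst v * ?Z * ?C, fst v * ?S]" for v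
    by (simp add: tangent_vector_def X Xs Xt vec_eq_iff forall_3)
  have inner: "metric_inner sol_metric (?X s t) (tangent_vector ?X s t v) (tangent_vector ?X s t v') =
      fst v * fst v' + (?Z * snd v) * (?Z * snd v')" for v v'
  proof -
    have "exp (2 * z s) = ?Z\<^sup>2" "exp (- (2 * z s)) * ?Z\<^sup>2 = 1"
      by (simp_all add: power2_eq_square exp_add [symmetric])
    moreover have "?S\<^sup>2 + ?C\<^sup>2 = 1" by simp
    ultimately have "snd v * snd v' * exp (2 * z s) +
       fst v * fst v' * (exp (- (2 * z s)) * ?Z\<^sup>2 * ?C\<^sup>2 + ?S\<^sup>2)
       = fst v * fst v' + (?Z * snd v) * (?Z * snd v')"
      by algebra
    then show ?thesis
      by (simp add: metric_inner_def tan inner_vec_def sum_3 matrix_vector_mult_def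
          inv_surface_def algebra_simps power2_eq_square)
  qed
  have shape: "shape_operator sol_metric ?X ?N s t v =
      vector [- ?C * snd v, (w + ?C) * fst v * ?Z * ?C, (w + ?C) * fst v * ?S]" for v
  proof -
    have Z: "exp (2 * z s) = ?Z\<^sup>2" "exp (- (2 * z s)) * ?Z\<^sup>2 = 1"
      by (simp_all add: power2_eq_square exp_add [symmetric])
    show ?thesis
      by (simp add: shape_operator_def cov_deriv_along_def X N Xs Xt Ns vec_eq_iff forall_3 sum_3
          christoffel_sol_metric) (use Z in \<open>simp add: algebra_simps power2_eq_square\<close>)
  qed
  have eigen: "shape_operator sol_metric ?X ?N s t v = k *\<^sub>R tangent_vector ?X s t v \<longleftrightarrow>
      (w + ?C) * fst v = k * fst v \<and> (- ?C) * (?Z * snd v) = k * (?Z * snd v)" for v k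
  proof -
    have "shape_operator sol_metric ?X ?N s t v = k *\<^sub>R tangent_vector ?X s t v \<longleftrightarrow>
        (- ?C - k) * snd v = 0 \<and> ((w + ?C - k) * fst v) * (?Z * ?C) = 0 \<and>
        ((w + ?C - k) * fst v) * ?S = 0"
      by (simp add: shape tan vec_eq_iff forall_3 left_diff_distrib mult.assoc
          del: mult_eq_0_iff mult_minus_left)
    also have "\<dots> \<longleftrightarrow> (- ?C - k) * (?Z * snd v) = 0 \<and> (w + ?C - k) * fst v = 0"
      using sin_zero_norm_cos_one [of "\<theta> s"] by auto
    also have "\<dots> \<longleftrightarrow> (w + ?C) * fst v = k * fst v \<and> (- ?C) * (?Z * snd v) = k * (?Z * snd v)"
      unfolding left_diff_distrib by auto
    finally show ?thesis .
  qed
  show ?thesis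
  proof
    assume "has_mean_curvature sol_metric ?X ?N s t H"
    then obtain k k' v v' where "H = (k + k') / 2"
      and orth: "metric_inner sol_metric (?X s t) (tangent_vector ?X s t v) (tangent_vector ?X s t v) = 1"
        "metric_inner sol_metric (?X s t) (tangent_vector ?X s t v') (tangent_vector ?X s t v') = 1"
        "metric_inner sol_metric (?X s t) (tangent_vector ?X s t v) (tangent_vector ?X s t v') = 0"
      and ev: "shape_operator sol_metric ?X ?N s t v = k *\<^sub>R tangent_vector ?X s t v"
        "shape_operator sol_metric ?X ?N s t v' = k' *\<^sub>R tangent_vector ?X s t v'"
      unfolding has_mean_curvature_def principal_curvatures_def by blast
    moreover have "k + k' = (w + ?C) + (- ?C)"
      by (rule trace_of_diagonal_in_orthonormal_basis
            [of "fst v" "?Z * snd v" "fst v'" "?Z * snd v'"])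
        (use orth ev in \<open>simp_all only: inner eigen power2_eq_square\<close>)
    ultimately show "w = 2 * H" by simp
  next
    assume "w = 2 * H"
    have "principal_curvatures sol_metric ?X ?N s t (w + ?C) (- ?C)"
      unfolding principal_curvatures_def
      by (rule exI [of _ "(1, 0)"], rule exI [of _ "(0, exp (- z s))"])
        (simp add: inner eigen exp_minus del: scaleR_minus_left)
    moreover have "H = ((w + ?C) + - ?C) / 2"
      using \<open>w = 2 * H\<close> by simp
    ultimately show "has_mean_curvature sol_metric ?X ?N s t H"
      unfolding has_mean_curvature_def by blast
  qed
qed

section \<open>The ordinate as a function of the angle\<close>

text \<open>
  Write \<open>e = exp (c - k cos \<phi>)\<close>. Since \<open>(e sin \<phi>)' = e cos \<phi> + k e sin\<^sup>2 \<phi>\<close>, the function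
  \<open>P - k e sin \<phi>\<close> has derivative \<open>- k\<^sup>2 e sin\<^sup>2 \<phi> \<le> 0\<close>. The correction term vanishes at multiples of
  \<open>\<pi>\<close>, so \<open>P\<close> itself decreases over a full turn, whatever the sign of \<open>k\<close>.
\<close>

lemma profile_translation:
  assumes P: "\<And>\<phi>. (P has_real_derivative k * exp (c - k * cos \<phi>) * cos \<phi>) (at \<phi>)"
    and "k \<noteq> 0"
  obtains \<tau> where "\<tau> < 0" "\<And>\<phi>. P (\<phi> + 2 * pi) = P \<phi> + \<tau>"
proof -
  have "((\<lambda>\<phi>. P (\<phi> + 2 * pi) - P \<phi>) has_real_derivative 0) (at \<phi>)" for \<phi>
  proof -
    have "((\<lambda>\<phi>. P (\<phi> + 2 * pi)) has_real_derivative k * exp (c - k * cos \<phi>) * cos \<phi>) (at \<phi>)"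
      using P [of "\<phi> + 2 * pi"] by (simp add: DERIV_shift)
    from DERIV_diff [OF this P] show ?thesis by simp
  qed
  then have const: "P (\<phi> + 2 * pi) - P \<phi> = P (0 + 2 * pi) - P 0" for \<phi>
    by (rule DERIV_isconst_all [rule_format, of _ \<phi> 0]) 
  define g where "g \<phi> = P \<phi> - k * exp (c - k * cos \<phi>) * sin \<phi>" for \<phi>
  have g: "(g has_real_derivative - (k\<^sup>2 * exp (c - k * cos \<phi>) * (sin \<phi>)\<^sup>2)) (at \<phi>)" for \<phi>
    unfolding g_def
    by (rule derivative_eq_intros P refl | simp add: power2_eq_square algebra_simps)+
  have "g pi < g 0"
  proof (rule DERIV_neg_imp_decreasing_open [of 0 pi])
    show "continuous_on {0..pi} g"
      by (rule DERIV_continuous_on) (use g has_field_derivative_at_within in blast)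
    show "\<exists>d. (g has_real_derivative d) (at x) \<and> d < 0" if "0 < x" "x < pi" for x
    proof -
      have "sin x \<noteq> 0" using sin_gt_zero [OF that] by simp
      then have "k\<^sup>2 * exp (c - k * cos x) * (sin x)\<^sup>2 > 0" using \<open>k \<noteq> 0\<close> by simp
      then show ?thesis using g [of x] by (meson neg_less_0_iff_less)
    qed
  qed simp
  moreover have "g (2 * pi) \<le> g pi"
    by (rule DERIV_nonpos_imp_nonincreasing [of pi]) (auto intro!: exI g)
  ultimately have "P (0 + 2 * pi) - P 0 < 0"
    by (simp add: g_def)
  with const show thesis
    by (intro that [of "P (0 + 2 * pi) - P 0"]) (auto simp: algebra_simps)
qed

text \<open>
  At a zero \<open>m\<close> of the sine, \<open>cos\<close> is even about \<open>m\<close>, hence so is the derivative of \<open>P\<close>, and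
  \<open>P - P m\<close> is odd. As the height is even about \<open>m\<close>, the curve is symmetric in a vertical line there.
\<close>

lemma profile_reflection:
  assumes P: "\<And>\<phi>. (P has_real_derivative k * exp (c - k * cos \<phi>) * cos \<phi>) (at \<phi>)"
    and "sin m = 0"
  shows "P (m + u) + P (m - u) = 2 * P m"
proof -
  have "((\<lambda>u. P (m + u) + P (m - u)) has_real_derivative 0) (at u)" for u
  proof -
    have "((\<lambda>u. P (m + u)) has_real_derivative k * exp (c - k * cos (m + u)) * cos (m + u) * 1) (at u)"
      by (rule DERIV_chain2 [OF P]) (auto intro!: derivative_eq_intros)
    moreover
    have "((\<lambda>u. P (m - u)) has_real_derivative k * exp (c - k * cos (m - u)) * cos (m - u) * (- 1)) (at u)"
      by (rule DERIV_chain2 [OF P]) (auto intro!: derivative_eq_intros)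
    moreover have "cos (m - u) = cos (m + u)"
      by (simp add: cos_add cos_diff \<open>sin m = 0\<close>)
    ultimately show ?thesis
      using DERIV_add by fastforce
  qed
  then have "P (m + u) + P (m - u) = P (m + 0) + P (m - 0)"
    by (rule DERIV_isconst_all [rule_format, of _ u 0])
  then show ?thesis by simp
qed

text \<open>
  A point on the axis of symmetry other than the one at the centre \<open>m\<close> is mapped to itself by the
  reflection, but is reached at two opposite parameters. Such a point exists because \<open>P\<close> crosses
  the level \<open>P m\<close> again within one turn after \<open>m\<close>.
\<close>

lemma profile_double_point:
  assumes P: "\<And>\<phi>. (P has_real_derivative k * exp (c - k * cos \<phi>) * cos \<phi>) (at \<phi>)"
    and "k \<noteq> 0"
  obtains a b where "a \<noteq> b" "cos a = cos b" "P a = P b"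
proof -
  obtain \<tau> where \<tau>: "\<tau> < 0" "\<And>\<phi>. P (\<phi> + 2 * pi) = P \<phi> + \<tau>"
    using profile_translation [OF assms] by blast
  \<comment> \<open>The centre at which the curve moves against the drift \<open>\<tau>\<close>.\<close>
  define m where "m = (if k > 0 then 0 else pi)"
  have m: "sin m = 0" "k * cos m > 0"
    using \<open>k \<noteq> 0\<close> by (auto simp: m_def)
  have "k * exp (c - k * cos m) * cos m > 0"
    using mult_pos_pos [OF m(2) exp_gt_zero] by (simp add: mult_ac)
  then obtain d where d: "d > 0" "\<And>h. 0 < h \<Longrightarrow> h < d \<Longrightarrow> P m < P (m + h)"
    using DERIV_pos_inc_right [OF P] by blast
  define e where "e = min (d / 2) pi"
  have e: "0 < e" "e < 2 * pi" "P m < P (m + e)"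
    using d pi_gt_zero by (auto simp: e_def min_def)
  have "\<exists>x\<ge>m + e. x \<le> m + 2 * pi \<and> P x = P m"
    by (rule IVT2')
      (use e \<tau> in \<open>auto intro!: continuous_at_imp_continuous_on DERIV_isCont [OF P]\<close>)
  then obtain x where x: "x \<ge> m + e" "P x = P m" by blast
  define u where "u = x - m"
  have "u > 0" "P (m + u) = P m"
    using x e by (auto simp: u_def)
  moreover have "P (m + u) + P (m - u) = 2 * P m"
    by (rule profile_reflection [OF P m(1)])
  ultimately show thesis
    by (intro that [of "m + u" "m - u"]) (auto simp: cos_add cos_diff m)
qed

section \<open>Generating curves of constant mean curvature\<close>

lemma cmc_generating_curve_derivs:
  assumes "cmc_generating_curve H I y z \<theta>" "s \<in> I"
  shows "(y has_real_derivative exp (z s) * cos (\<theta> s)) (at s)"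
    and "(z has_real_derivative sin (\<theta> s)) (at s)"
    and "(\<theta> has_real_derivative 2 * H) (at s)"
proof -
  show y: "(y has_real_derivative exp (z s) * cos (\<theta> s)) (at s)"
    and z: "(z has_real_derivative sin (\<theta> s)) (at s)"
    using assms by (auto simp: cmc_generating_curve_def)
  have "((deriv ^^ 0) \<theta>) differentiable_on I" "open I"
    using assms unfolding cmc_generating_curve_def smooth_on_open_def by blast+
  then have "\<theta> differentiable (at s)"
    using assms(2) by (simp add: differentiable_on_eq_differentiable_at)
  then obtain w where w: "(\<theta> has_real_derivative w) (at s)"
    by (metis real_differentiable_def)
  moreover have "has_mean_curvature sol_metric (inv_surface y z) (inv_normal y z \<theta>) s 0 H"
    using assms by (auto simp: cmc_generating_curve_def)
  ultimately show "(\<theta> has_real_derivative 2 * H) (at s)"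
    using has_mean_curvature_inv_surface_iff [OF y z w] by simp
qed

text \<open>Since \<open>\<theta>' = 2 H\<close>, the equation \<open>z' = sin \<theta>\<close> says that \<open>z + cos \<theta> / (2 H)\<close> has derivative zero.\<close>

lemma cmc_generating_curve_closed_form:
  assumes "cmc_generating_curve H I y z \<theta>" and "H \<noteq> 0"
  obtains \<theta>\<^sub>0 c where "\<And>s. s \<in> I \<Longrightarrow> \<theta> s = 2 * H * s + \<theta>\<^sub>0"
    and "\<And>s. s \<in> I \<Longrightarrow> z s = c - cos (\<theta> s) / (2 * H)"
proof -
  have "convex I"
    using assms(1) by (simp add: cmc_generating_curve_def is_interval_convex)
  note d = cmc_generating_curve_derivs [OF assms(1)]
  have "\<exists>a. \<forall>s\<in>I. \<theta> s - 2 * H * s = a"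
  proof (rule has_field_derivative_zero_constant [OF \<open>convex I\<close>])
    fix s assume "s \<in> I"
    have "((\<lambda>s. 2 * H * s) has_real_derivative 2 * H) (at s)"
      by (auto intro!: derivative_eq_intros)
    from DERIV_diff [OF d(3) [OF \<open>s \<in> I\<close>] this]
    show "((\<lambda>s. \<theta> s - 2 * H * s) has_real_derivative 0) (at s within I)"
      by (simp add: has_field_derivative_at_within)
  qed
  moreover have "\<exists>a. \<forall>s\<in>I. z s + cos (\<theta> s) / (2 * H) = a"
  proof (rule has_field_derivative_zero_constant [OF \<open>convex I\<close>])
    fix s assume "s \<in> I"
    have "((\<lambda>s. z s + cos (\<theta> s) / (2 * H)) has_real_derivative
        sin (\<theta> s) + - sin (\<theta> s) * (2 * H) / (2 * H)) (at s)"
      by (intro DERIV_add DERIV_cdivide DERIV_fun_cos d \<open>s \<in> I\<close>)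
    then show "((\<lambda>s. z s + cos (\<theta> s) / (2 * H)) has_real_derivative 0) (at s within I)"
      using \<open>H \<noteq> 0\<close> by (simp add: has_field_derivative_at_within)
  qed
  ultimately obtain a b where "\<forall>s\<in>I. \<theta> s - 2 * H * s = a" "\<forall>s\<in>I. z s + cos (\<theta> s) / (2 * H) = b"
    by blast
  then show thesis
    by (intro that [of a b]) (auto simp: algebra_simps)
qed

lemma differentiable_on_affine: "(\<lambda>s. c * s + d) differentiable_on I" for c d :: real
  by (intro derivative_intros)

text \<open>The class of affine functions is closed under \<open>deriv\<close>, which lets the induction on the order go through.\<close>

lemma smooth_on_open_affine: "smooth_on_open I (\<lambda>s. a * s + b)"
proof -
  have "deriv (\<lambda>s. c * s + d) = (\<lambda>s. 0 * s + c)" for c d :: real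
    by (rule ext, rule DERIV_imp_deriv) (auto intro!: derivative_eq_intros)
  then have "\<exists>c d. (deriv ^^ k) (\<lambda>s. a * s + b) = (\<lambda>s. c * s + d)" for k
  proof (induction k)
    case 0
    show ?case
      unfolding funpow_0 by blast
  next
    case (Suc k)
    then show ?case
      by (metis comp_apply funpow.simps(2))
  qed
  then show ?thesis
    unfolding smooth_on_open_def by (metis differentiable_on_affine)
qed

text \<open>
  The converse of the closed form: the explicit solutions are generating curves of mean curvature
  \<open>H\<close> on the whole line, and serve as competitors in the definition of maximality.
\<close>

lemma cmc_generating_curve_UNIV:
  assumes "H \<noteq> 0"
    and y: "\<And>s. (y has_real_derivative exp (z s) * cos (2 * H * s + \<theta>\<^sub>0)) (at s)"
    and z: "\<And>s. z s = c - cos (2 * H * s + \<theta>\<^sub>0) / (2 * H)"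
  shows "cmc_generating_curve H UNIV y z (\<lambda>s. 2 * H * s + \<theta>\<^sub>0)"
proof -
  have z': "(z has_real_derivative sin (2 * H * s + \<theta>\<^sub>0)) (at s)" for s
    unfolding z using \<open>H \<noteq> 0\<close> by (auto intro!: derivative_eq_intros)
  have "((\<lambda>s. 2 * H * s + \<theta>\<^sub>0) has_real_derivative 2 * H) (at s)" for s
    by (auto intro!: derivative_eq_intros)
  from has_mean_curvature_inv_surface_iff [OF y z' this] y z' show ?thesis
    by (auto simp: cmc_generating_curve_def smooth_on_open_affine)
qed

text \<open>
  The closed form of \<open>z\<close> and \<open>\<theta>\<close> on \<open>I\<close> makes sense on \<open>\<real>\<close>, and so does a primitive of the
  resulting \<open>y'\<close>; normalised by a constant it extends \<open>y\<close>.
\<close>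

lemma maximal_cmc_generating_curve_UNIV:
  assumes max: "maximal_cmc_generating_curve H I y z \<theta>" and "H \<noteq> 0"
  shows "I = UNIV"
proof -
  have cmc: "cmc_generating_curve H I y z \<theta>"
    using max by (simp add: maximal_cmc_generating_curve_def)
  obtain \<theta>\<^sub>0 c where \<theta>: "\<And>s. s \<in> I \<Longrightarrow> \<theta> s = 2 * H * s + \<theta>\<^sub>0"
    and z: "\<And>s. s \<in> I \<Longrightarrow> z s = c - cos (\<theta> s) / (2 * H)"
    using cmc_generating_curve_closed_form [OF cmc \<open>H \<noteq> 0\<close>] by blast
  define z\<^sub>1 where "z\<^sub>1 s = c - cos (2 * H * s + \<theta>\<^sub>0) / (2 * H)" for s
  have "\<exists>F. \<forall>s. - \<infinity> < ereal s \<longrightarrow> ereal s < \<infinity> \<longrightarrow>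
      (F has_vector_derivative exp (z\<^sub>1 s) * cos (2 * H * s + \<theta>\<^sub>0)) (at s)"
    by (rule einterval_antiderivative)
      (use \<open>H \<noteq> 0\<close> in \<open>auto simp: z\<^sub>1_def intro!: continuous_intros\<close>)
  then obtain F where F: "\<And>s. (F has_real_derivative exp (z\<^sub>1 s) * cos (2 * H * s + \<theta>\<^sub>0)) (at s)"
    by (auto simp: has_real_derivative_iff_has_vector_derivative)
  have "\<exists>a. \<forall>s\<in>I. y s - F s = a"
  proof (rule has_field_derivative_zero_constant)
    show "convex I"
      using cmc by (simp add: cmc_generating_curve_def is_interval_convex)
    show "((\<lambda>s. y s - F s) has_real_derivative 0) (at s within I)" if "s \<in> I" for s
      using DERIV_diff [OF cmc_generating_curve_derivs(1) [OF cmc that] F [of s]]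
      by (simp add: \<theta> z z\<^sub>1_def that has_field_derivative_at_within)
  qed
  then obtain a where a: "\<And>s. s \<in> I \<Longrightarrow> y s = F s + a"
    by (metis add.commute diff_add_cancel)
  have "cmc_generating_curve H UNIV (\<lambda>s. F s + a) z\<^sub>1 (\<lambda>s. 2 * H * s + \<theta>\<^sub>0)"
    by (rule cmc_generating_curve_UNIV [OF \<open>H \<noteq> 0\<close> _ z\<^sub>1_def])
      (auto intro!: derivative_eq_intros F)
  moreover have "\<forall>s\<in>I. gen_curve (\<lambda>s. F s + a) z\<^sub>1 s = gen_curve y z s"
    by (simp add: gen_curve_def a z \<theta> z\<^sub>1_def)
  ultimately show ?thesis
    using max unfolding maximal_cmc_generating_curve_def by blast
qed

section \<open>The global shape of the generating curve\<close>

theorem theorem3p2: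
  fixes H :: real and I :: "real set" and y z \<theta> :: "real \<Rightarrow> real"
  assumes "H \<noteq> 0"
    and "maximal_cmc_generating_curve H I y z \<theta>"
  shows "I = UNIV \<and>
    (\<exists>\<tau>. \<tau> \<noteq> 0 \<and>
       (\<forall>n::int. (\<lambda>p. p + vector [0, of_int n * \<tau>, 0]) ` range (gen_curve y z)
                   = range (gen_curve y z))) \<and>
    (bounded (range z) \<and> (\<exists>T>0. \<forall>s. z (s + T) = z s)) \<and>
    (\<exists>s1 s2. s1 \<noteq> s2 \<and> gen_curve y z s1 = gen_curve y z s2) \<and>
    ((\<forall>s. (gen_curve y z has_vector_derivative
             cos (\<theta> s) *\<^sub>R E2 (gen_curve y z s) + sin (\<theta> s) *\<^sub>R E3 (gen_curve y z s)) (at s)) \<and>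
     (strict_mono \<theta> \<or> strict_antimono_on UNIV \<theta>) \<and>
     (\<forall>a b. a\<^sup>2 + b\<^sup>2 = 1 \<longrightarrow>
        (\<exists>s. vector_derivative (gen_curve y z) (at s)
               = a *\<^sub>R E2 (gen_curve y z s) + b *\<^sub>R E3 (gen_curve y z s))))"
proof -
  have I: "I = UNIV"
    using maximal_cmc_generating_curve_UNIV assms by blast
  have cmc: "cmc_generating_curve H UNIV y z \<theta>"
    using assms(2) by (simp add: maximal_cmc_generating_curve_def I)
  obtain \<theta>\<^sub>0 c where \<theta>: "\<And>s. \<theta> s = 2 * H * s + \<theta>\<^sub>0" and z: "\<And>s. z s = c - cos (\<theta> s) / (2 * H)"
    using cmc_generating_curve_closed_form [OF cmc \<open>H \<noteq> 0\<close>] by auto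
  define k where "k = 1 / (2 * H)"
  \<comment> \<open>The inverse of \<open>\<theta>\<close>, to pass to the angle as parameter.\<close>
  define \<sigma> where "\<sigma> \<phi> = k * (\<phi> - \<theta>\<^sub>0)" for \<phi>
  have k: "k \<noteq> 0" "2 * H * k = 1"
    using \<open>H \<noteq> 0\<close> by (auto simp: k_def)
  have \<theta>_\<sigma>: "\<theta> (\<sigma> \<phi>) = \<phi>" for \<phi>
    using \<open>H \<noteq> 0\<close> by (simp add: \<sigma>_def \<theta> k_def)
  have \<sigma>_\<theta>: "\<sigma> (\<theta> s) = s" for s
    using \<open>H \<noteq> 0\<close> by (simp add: \<sigma>_def \<theta> k_def)
  define P where "P \<phi> = y (\<sigma> \<phi>)" for \<phi>
  have P: "(P has_real_derivative k * exp (c - k * cos \<phi>) * cos \<phi>) (at \<phi>)" for \<phi>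
  proof -
    have "(\<sigma> has_real_derivative k) (at \<phi>)"
      unfolding \<sigma>_def by (auto intro!: derivative_eq_intros)
    from DERIV_chain2 [OF cmc_generating_curve_derivs(1) [OF cmc UNIV_I] this]
    show ?thesis
      unfolding P_def by (simp add: z \<theta>_\<sigma>) (simp add: k_def mult_ac)
  qed
  have curve: "gen_curve y z s = vector [0, P (\<theta> s), c - k * cos (\<theta> s)]" for s
    by (simp add: gen_curve_def P_def \<sigma>_\<theta> z k_def)

  obtain \<tau> where \<tau>: "\<tau> < 0" "\<And>\<phi>. P (\<phi> + 2 * pi) = P \<phi> + \<tau>"
    using profile_translation [OF P k(1)] by blast
  \<comment> \<open>The parameter length of a turn of \<open>\<theta>\<close>, negative if \<open>H < 0\<close>; hence \<open>\<bar>T\<bar>\<close> as period of \<open>z\<close> below.\<close>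
  define T where "T = 2 * pi * k"
  have \<theta>_T: "\<theta> (s + r * T) = \<theta> s + r * (2 * pi)" for s r
    using k(2) by (simp add: \<theta> T_def algebra_simps)
  have shift: "gen_curve y z (s + of_int n * T) = gen_curve y z s + vector [0, of_int n * \<tau>, 0]" for s n
  proof -
    have P_add: "P (\<phi> + of_nat m * (2 * pi)) = P \<phi> + of_nat m * \<tau>" for \<phi> m
    proof (induction m)
      case (Suc m)
      then show ?case
        using \<tau>(2) [of "\<phi> + of_nat m * (2 * pi)"] by (simp add: algebra_simps)
    qed simp
    have "P (\<phi> + of_int n * (2 * pi)) = P \<phi> + of_int n * \<tau>" for \<phi>
    proof (cases n rule: int_cases2)
      case (nonneg m)
      then show ?thesis using P_add [of \<phi> m] by simp
    next
      case (nonpos m)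
      then show ?thesis using P_add [of "\<phi> - of_nat m * (2 * pi)" m] by simp
    qed
    moreover have "cos (\<phi> + of_int n * (2 * pi)) = cos \<phi>" for \<phi>
      using cos_int_2pin [of n] sin_int_2pin [of n] by (simp add: cos_add mult_ac)
    ultimately show ?thesis
      by (simp add: curve \<theta>_T vec_eq_iff forall_3)
  qed
  have "(\<lambda>p. p + vector [0, of_int n * \<tau>, 0]) ` range (gen_curve y z) = range (gen_curve y z)" for n
  proof -
    have "(\<lambda>p. p + vector [0, of_int n * \<tau>, 0]) ` range (gen_curve y z)
        = range (\<lambda>s. gen_curve y z (s + of_int n * T))"
      by (simp add: shift image_image)
    also have "\<dots> = gen_curve y z ` range (\<lambda>s. s + of_int n * T)"
      by (simp only: image_image)
    also have "range (\<lambda>s. s + of_int n * T) = UNIV"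
      by (rule surjI [of _ "\<lambda>s. s - of_int n * T"]) simp
    finally show ?thesis .
  qed
  then have 1: "\<exists>\<tau>. \<tau> \<noteq> 0 \<and> (\<forall>n::int. (\<lambda>p. p + vector [0, of_int n * \<tau>, 0]) ` range (gen_curve y z)
                   = range (gen_curve y z))"
    using \<tau>(1) by (intro exI [of _ \<tau>]) auto

  have "\<bar>z s\<bar> \<le> \<bar>c\<bar> + \<bar>k\<bar>" for s
  proof -
    have "\<bar>k * cos (\<theta> s)\<bar> \<le> \<bar>k\<bar>"
      by (simp add: abs_mult mult_left_le)
    moreover have "z s = c - k * cos (\<theta> s)"
      by (simp add: z k_def)
    ultimately show ?thesis
      by linarith
  qed
  then have bdd: "bounded (range z)"
    by (auto simp: bounded_iff)
  have "z (s + r * T) = z s" if "r = 1 \<or> r = - 1" for s r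
    using that by (auto simp: z \<theta>_T cos_diff)
  then have "z (s + \<bar>T\<bar>) = z s" for s
    by (metis abs_if mult_1 mult_minus1)
  moreover have "\<bar>T\<bar> > 0"
    using k(1) by (simp add: T_def)
  ultimately have per: "\<exists>T>0. \<forall>s. z (s + T) = z s"
    by blast

  obtain \<phi> \<psi> where "\<phi> \<noteq> \<psi>" "cos \<phi> = cos \<psi>" "P \<phi> = P \<psi>"
    using profile_double_point [OF P k(1)] by blast
  then have 3: "\<exists>s1 s2. s1 \<noteq> s2 \<and> gen_curve y z s1 = gen_curve y z s2"
    by (intro exI [of _ "\<sigma> \<phi>"] exI [of _ "\<sigma> \<psi>"]) (metis curve \<theta>_\<sigma>)

  have vel: "(gen_curve y z has_vector_derivative
             cos (\<theta> s) *\<^sub>R E2 (gen_curve y z s) + sin (\<theta> s) *\<^sub>R E3 (gen_curve y z s)) (at s)" for s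
  proof -
    have "((\<lambda>s. gen_curve y z s) has_vector_derivative vector [0, exp (z s) * cos (\<theta> s), sin (\<theta> s)]) (at s)"
      unfolding gen_curve_def
      by (rule has_vector_derivative_vector_3 cmc_generating_curve_derivs [OF cmc UNIV_I] DERIV_const)+
    moreover have "cos (\<theta> s) *\<^sub>R E2 (gen_curve y z s) + sin (\<theta> s) *\<^sub>R E3 (gen_curve y z s)
        = vector [0, exp (z s) * cos (\<theta> s), sin (\<theta> s)]"
      by (simp add: gen_curve_def E2_def E3_def vec_eq_iff forall_3)
    ultimately show ?thesis by simp
  qed
  have mono: "strict_mono \<theta> \<or> strict_antimono_on UNIV \<theta>"
  proof (cases "H > 0")
    case True
    then have "strict_mono \<theta>"
      by (auto simp: strict_mono_def \<theta>)
    then show ?thesis ..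
  next
    case False
    with \<open>H \<noteq> 0\<close> have "strict_antimono_on UNIV \<theta>"
      by (auto simp: monotone_on_def \<theta>)
    then show ?thesis ..
  qed
  have "\<exists>s. vector_derivative (gen_curve y z) (at s)
               = a *\<^sub>R E2 (gen_curve y z s) + b *\<^sub>R E3 (gen_curve y z s)" if "a\<^sup>2 + b\<^sup>2 = 1" for a b
  proof -
    obtain \<phi> where "a = cos \<phi>" "b = sin \<phi>"
      using sincos_total_2pi [OF \<open>a\<^sup>2 + b\<^sup>2 = 1\<close>] by metis
    then show ?thesis
      by (intro exI [of _ "\<sigma> \<phi>"]) (simp add: vector_derivative_at [OF vel] \<theta>_\<sigma>)
  qed
  with I 1 bdd per 3 vel mono show ?thesis
    by blast
qed

end
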